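(* Let $\mathcal{H}$ be a real Hilbert space, let $T:\mathcal{H}\to\mathcal{H}$ be nonexpansive, let $\lambda:[0,+\infty)\to[0,1]$ be a Lebesgue measurable function and let $x_0\in\mathcal{H}$. Then the dynamical system $$\dot x(t)=\lambda(t)\big(T(x(t))-x(t)\big),\qquad x(0)=x_0,$$ has a unique strong global solution $x:[0,+\infty)\to\mathcal{H}$.
   Context: $T$ is nonexpansive if $\|Tx-Ty\|\le\|x-y\|$ for all $x,y\in\mathcal{H}$. A function $f:[0,b]\to\mathcal{H}$ ($b>0$) is absolutely continuous if there exists an integrable function $g:[0,b]\to\mathcal{H}$ such that $f(t)=f(0)+\int_0^t g(s)\,ds$ for all $t\in[0,b]$ (equivalently, $f$ satisfies the usual $\varepsilon$-$\eta$ definition of absolute continuity). Such a function is differentiable almost everywhere. A function $x:[0,+\infty)\to\mathcal{H}$ is a strong global solution of the system if (i) $x$ is absolutely continuous on each interval $[0,b]$, $0<b<+\infty$; (ii) $\dot x(t)=\lambda(t)\big(T(x(t))-x(t)\big)$ for almost all $t\in[0,+\infty)$; (iii) $x(0)=x_0$. *)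

theory Defs
  imports "HOL-Analysis.Analysis"
begin

definition nonexpansive :: "('a::real_normed_vector \<Rightarrow> 'a) \<Rightarrow> bool" where
  "nonexpansive T \<longleftrightarrow> (\<forall>x y. norm (T x - T y) \<le> norm (x - y))"

text \<open>The library's predicate \<open>has_bochner_integral\<close> is confined to second countable (i.e.
  separable) spaces. Its definition is repeated here without that restriction, since the Hilbert
  space need not be separable. Being a limit in mean of simple functions, the integrand is
  automatically almost everywhere a pointwise limit of simple functions, so this is the usual
  Bochner integral in a general Banach space.\<close>

definition has_Bochner_integral ::
    "'b measure \<Rightarrow> ('b \<Rightarrow> 'a::real_normed_vector) \<Rightarrow> 'a \<Rightarrow> bool" where
  "has_Bochner_integral M f I \<longleftrightarrow>
     f \<in> borel_measurable M \<and>
     (\<exists>s. (\<forall>i. Bochner_Integration.simple_bochner_integrable M (s i)) \<and>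
          (\<lambda>i. \<integral>\<^sup>+x. norm (f x - s i x) \<partial>M) \<longlonglongrightarrow> 0 \<and>
          (\<lambda>i::nat. Bochner_Integration.simple_bochner_integral M (s i)) \<longlonglongrightarrow> I)"

lemma has_Bochner_integral_iff_library:
  fixes I :: "'a::{real_normed_vector, second_countable_topology}"
  shows "has_Bochner_integral M f I \<longleftrightarrow> has_bochner_integral M f I"
  unfolding has_Bochner_integral_def has_bochner_integral.simps by blast

definition Bochner_integrable :: "'b measure \<Rightarrow> ('b \<Rightarrow> 'a::real_normed_vector) \<Rightarrow> bool" where
  "Bochner_integrable M f \<longleftrightarrow> (\<exists>I. has_Bochner_integral M f I)"

definition abs_continuous_upto :: "real \<Rightarrow> (real \<Rightarrow> 'a::real_normed_vector) \<Rightarrow> bool" where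
  "abs_continuous_upto b f \<longleftrightarrow>
     (\<exists>g. Bochner_integrable (lebesgue_on {0..b}) g \<and>
          (\<forall>t\<in>{0..b}. \<exists>I. has_Bochner_integral (lebesgue_on {0..t}) g I \<and> f t = f 0 + I))"

text \<open>Functions on \<open>[0, \<infinity>)\<close> are represented by functions on \<open>real\<close> whose values at negative
  arguments are irrelevant; in particular the derivative is taken within \<open>[0, \<infinity>)\<close>.\<close>

definition strong_global_solution ::
    "('a::real_normed_vector \<Rightarrow> 'a) \<Rightarrow> (real \<Rightarrow> real) \<Rightarrow> 'a \<Rightarrow> (real \<Rightarrow> 'a) \<Rightarrow> bool" where
  "strong_global_solution T lam x0 x \<longleftrightarrow>
     (\<forall>b>0. abs_continuous_upto b x) \<and>
     (AE t in lebesgue_on {0..}.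
        (x has_vector_derivative lam t *\<^sub>R (T (x t) - x t)) (at t within {0..})) \<and>
     x 0 = x0"

end

theory Submission
  imports Defs
begin

text \<open>Existence: the integral equation \<open>x t = x0 + \<integral>\<^sub>0\<^sup>t \<lambda> s (T (x s) - x s) ds\<close> is solved by Banach's
  fixed point theorem in the exponentially weighted sup norm. If \<open>w\<close> is continuous, then
  \<open>\<integral>\<^sub>0\<^sup>t \<lambda> w\<close> is differentiable with derivative \<open>\<lambda> t w t\<close> wherever the scalar function \<open>\<integral>\<^sub>0\<^sup>t \<lambda>\<close> has derivative
  \<open>\<lambda> t\<close>, so Lebesgue's differentiation theorem is only needed for the real function \<open>\<lambda>\<close>.

  Uniqueness: for two solutions \<open>x\<close> and \<open>y\<close>, the absolutely continuous function \<open>\<parallel>y - x\<parallel>\<^sup>2\<close> has almost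
  everywhere the derivative \<open>2 \<lambda> (\<langle>y - x, T y - T x\<rangle> - \<parallel>y - x\<parallel>\<^sup>2) \<le> 0\<close>, because \<open>T\<close> is nonexpansive. Hence
  it is nonincreasing, and it vanishes at \<open>0\<close>.\<close>

section \<open>Almost everywhere differentiation on the real line\<close>

text \<open>A gauge argument with two kinds of tags. At a tag outside \<open>N\<close> the
  derivative bounds the increment by a small multiple of the length; at a tag in \<open>N\<close>
  only the majorant \<open>k\<close> is available, but its integrals over such intervals have a
  small sum. The hypothesis \<open>inc\<close> is a one-sided absolute continuity; it excludes
  growth concentrated on a null set, as for the Cantor function.\<close>

lemma ae_nonpos_derivative_imp_le:
  fixes \<phi> k d :: "real \<Rightarrow> real"
  assumes ab: "a \<le> b" and N: "negligible N" and k: "k integrable_on {a..b}"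
    and inc: "\<And>u v. a \<le> u \<Longrightarrow> u \<le> v \<Longrightarrow> v \<le> b \<Longrightarrow> \<phi> v - \<phi> u \<le> integral {u..v} k"
    and der: "\<And>t. t \<in> {a..b} - N \<Longrightarrow> (\<phi> has_real_derivative d t) (at t within {a..b})"
    and le: "\<And>t. t \<in> {a..b} - N \<Longrightarrow> d t \<le> 0"
  shows "\<phi> b \<le> \<phi> a"
proof (rule field_le_epsilon)
  fix e :: real
  assume "e > 0"
  \<comment> \<open>Half of \<open>e\<close> goes to the intervals tagged outside \<open>N\<close>:
    their total length is at most \<open>b - a\<close>. The \<open>+ 1\<close> covers
    \<open>a = b\<close>.\<close>
  define \<eta> where "\<eta> = e / (2 * (b - a + 1))"
  have \<eta>: "\<eta> > 0" "\<eta> * (b - a) \<le> e / 2"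
    using ab \<open>e > 0\<close> by (auto simp: \<eta>_def divide_simps)
  \<comment> \<open>Since \<open>k0\<close> vanishes on \<open>N\<close>, Henstock's lemma makes the total integral of \<open>k\<close> over the intervals
    tagged in \<open>N\<close> small.\<close>
  define k0 where "k0 = (\<lambda>x. if x \<in> N then 0 else k x)"
  have k0_int: "k0 integrable_on cbox a b"
    using integrable_spike[OF k N, of k0] by (auto simp: k0_def)
  have k0_eq: "integral S k = integral S k0" for S
    by (rule integral_spike[OF N]) (auto simp: k0_def)
  obtain \<gamma> where \<gamma>: "gauge \<gamma>"
    and hen: "\<And>p. p tagged_partial_division_of cbox a b \<Longrightarrow> \<gamma> fine p \<Longrightarrow>
        (\<Sum>(x, K)\<in>p. norm (Henstock_Kurzweil_Integration.content K *\<^sub>R k0 x - integral K k0)) < e / 2"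
    by (rule Henstock_lemma[OF k0_int half_gt_zero[OF \<open>e > 0\<close>]]) (rule that)
  \<comment> \<open>For an interval that contains \<open>t\<close>, the linearisation errors on the
    two sides of \<open>t\<close> add up to at most \<open>\<eta> * (v - u)\<close>.\<close>
  have "\<exists>\<delta>>0. \<forall>u v. a \<le> u \<and> u \<le> t \<and> t \<le> v \<and> v \<le> b \<and> \<bar>u - t\<bar> < \<delta> \<and> \<bar>v - t\<bar> < \<delta>
           \<longrightarrow> \<phi> v - \<phi> u \<le> \<eta> * (v - u)" if t: "t \<in> {a..b} - N" for t
  proof -
    obtain \<delta> where "\<delta> > 0"
      and \<delta>: "\<And>y. y \<in> {a..b} \<Longrightarrow> norm (y - t) < \<delta> \<Longrightarrow> norm (\<phi> y - \<phi> t - d t * (y - t)) \<le> \<eta> * norm (y - t)"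
      using der[OF t] \<eta>(1) unfolding has_field_derivative_def has_derivative_within_alt by blast
    show ?thesis
    proof (intro exI[of _ \<delta>] conjI allI impI)
      fix u v
      assume uv: "a \<le> u \<and> u \<le> t \<and> t \<le> v \<and> v \<le> b \<and> \<bar>u - t\<bar> < \<delta> \<and> \<bar>v - t\<bar> < \<delta>"
      have "\<bar>\<phi> u - \<phi> t - d t * (u - t)\<bar> \<le> \<eta> * (t - u)" "\<bar>\<phi> v - \<phi> t - d t * (v - t)\<bar> \<le> \<eta> * (v - t)"
        using \<delta>[of u] \<delta>[of v] uv t by auto
      then have "\<phi> v - \<phi> u \<le> d t * (v - u) + \<eta> * (v - u)"
        by (simp add: abs_le_iff algebra_simps)
      moreover have "d t * (v - u) \<le> 0"
        using le[OF t] uv by (simp add: mult_nonpos_nonneg)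
      ultimately show "\<phi> v - \<phi> u \<le> \<eta> * (v - u)" by simp
    qed (use \<open>\<delta> > 0\<close> in auto)
  qed
  then obtain \<delta> where \<delta>_pos: "\<And>t. t \<in> {a..b} - N \<Longrightarrow> \<delta> t > 0"
    and \<delta>: "\<And>t u v. t \<in> {a..b} - N \<Longrightarrow> a \<le> u \<Longrightarrow> u \<le> t \<Longrightarrow> t \<le> v \<Longrightarrow> v \<le> b
       \<Longrightarrow> \<bar>u - t\<bar> < \<delta> t \<Longrightarrow> \<bar>v - t\<bar> < \<delta> t \<Longrightarrow> \<phi> v - \<phi> u \<le> \<eta> * (v - u)"
    by metis
  \<comment> \<open>One gauge for both purposes: Henstock's everywhere, and the radius of
    differentiability at tags outside \<open>N\<close>. The unit ball at the other tags imposes an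
    arbitrary bound.\<close>
  define \<gamma>' where "\<gamma>' = (\<lambda>t. \<gamma> t \<inter> (if t \<in> {a..b} - N then ball t (\<delta> t) else ball t 1))"
  have "gauge \<gamma>'"
    unfolding \<gamma>'_def by (intro gauge_Int \<gamma>) (use \<delta>_pos in \<open>auto simp: gauge_def\<close>)
  then obtain p where p: "p tagged_division_of {a..b}" and fine: "\<gamma>' fine p"
    using fine_division_exists_real by blast
  have "finite p" using p by auto
  define q where "q = {z\<in>p. fst z \<in> N}"
  have q: "q \<subseteq> p" "finite q"
    using \<open>finite p\<close> by (auto simp: q_def)
  have K: "\<exists>u v. K = {u..v} \<and> u \<le> x \<and> x \<le> v \<and> a \<le> u \<and> v \<le> b" if xK: "(x, K) \<in> p" for x K
  proof -
    obtain u v where "K = cbox u v"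
      using tagged_division_ofD(4)[OF p xK] by blast
    moreover have "x \<in> K" "K \<subseteq> {a..b}"
      using tagged_division_ofD(2,3)[OF p xK] .
    ultimately have "K = {u..v} \<and> u \<le> x \<and> x \<le> v \<and> a \<le> u \<and> v \<le> b" by auto
    then show ?thesis by auto
  qed
  let ?inc = "\<lambda>z. case z of (x, K) \<Rightarrow> \<phi> (Sup K) - \<phi> (Inf K)"
  have "(\<Sum>z\<in>q. ?inc z) \<le> (\<Sum>(x, K)\<in>q. norm (Henstock_Kurzweil_Integration.content K *\<^sub>R k0 x - integral K k0))"
  proof (rule sum_mono, clarify)
    fix x K
    assume xK: "(x, K) \<in> q"
    then obtain u v where uv: "K = {u..v}" "u \<le> x" "x \<le> v" "a \<le> u" "v \<le> b"
      using K q by blast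
    have "k0 x = 0"
      using xK by (auto simp: q_def k0_def)
    moreover have "\<phi> v - \<phi> u \<le> integral {u..v} k0"
      using inc[of u v] uv by (simp add: k0_eq)
    ultimately show "\<phi> (Sup K) - \<phi> (Inf K) \<le> norm (Henstock_Kurzweil_Integration.content K *\<^sub>R k0 x - integral K k0)"
      using uv by simp
  qed
  also have "\<dots> < e / 2"
  proof (rule hen)
    show "q tagged_partial_division_of cbox a b"
      using p q tagged_partial_division_subset by (fastforce simp: tagged_division_of_def)
    show "\<gamma> fine q"
      using fine q unfolding fine_def \<gamma>'_def by fast
  qed
  finally have 1: "(\<Sum>z\<in>q. ?inc z) < e / 2" .
  have "(\<Sum>z\<in>p - q. ?inc z) \<le> (\<Sum>z\<in>p - q. \<eta> * (case z of (x, K) \<Rightarrow> Henstock_Kurzweil_Integration.content K))"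
  proof (rule sum_mono, clarify)
    fix x K
    assume xK: "(x, K) \<in> p" "(x, K) \<notin> q"
    then obtain u v where uv: "K = {u..v}" "u \<le> x" "x \<le> v" "a \<le> u" "v \<le> b"
      using K by blast
    have x: "x \<in> {a..b} - N"
      using xK uv by (auto simp: q_def)
    have sub: "{u..v} \<subseteq> ball x (\<delta> x)"
      using fine xK x uv unfolding fine_def \<gamma>'_def by fastforce
    have "u \<in> ball x (\<delta> x)" "v \<in> ball x (\<delta> x)"
      using uv subsetD[OF sub, of u] subsetD[OF sub, of v] by auto
    then show "\<phi> (Sup K) - \<phi> (Inf K) \<le> \<eta> * Henstock_Kurzweil_Integration.content K"
      using \<delta>[OF x, of u v] uv by (simp add: dist_real_def abs_minus_commute)
  qed
  also have "\<dots> \<le> (\<Sum>z\<in>p. \<eta> * (case z of (x, K) \<Rightarrow> Henstock_Kurzweil_Integration.content K))"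
    using \<open>finite p\<close> \<eta>(1) by (intro sum_mono2) auto
  also have "\<dots> = \<eta> * (b - a)"
    using additive_content_tagged_division[of p a b] p ab by (simp flip: sum_distrib_left)
  finally have 2: "(\<Sum>z\<in>p - q. ?inc z) \<le> e / 2"
    using \<eta>(2) by simp
  have "\<phi> b - \<phi> a = (\<Sum>z\<in>p. ?inc z)"
    using additive_tagged_division_1[OF ab p, of \<phi>] by simp
  also have "\<dots> = (\<Sum>z\<in>p - q. ?inc z) + (\<Sum>z\<in>q. ?inc z)"
    using q \<open>finite p\<close> by (simp add: sum.subset_diff)
  finally show "\<phi> b \<le> \<phi> a + e"
    using 1 2 by simp
qed

text \<open>Lebesgue's differentiation theorem: outside two null sets both one-sided difference
  quotients converge. Within \<open>{a..}\<close> the endpoint \<open>a\<close> only involves the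
  right-hand one.\<close>

lemma integral_has_real_derivative_ae:
  fixes f :: "real \<Rightarrow> real"
  assumes f: "\<And>a b. f integrable_on {a..b}"
  obtains N where "negligible N"
    "\<And>x. x \<notin> N \<Longrightarrow> a \<le> x \<Longrightarrow> ((\<lambda>t. integral {a..t} f) has_real_derivative f x) (at x within {a..})"
proof -
  obtain N1 where N1: "negligible N1"
    and right: "\<And>x e. x \<notin> N1 \<Longrightarrow> 0 < e \<Longrightarrow>
      \<exists>d>0. \<forall>h. 0 < h \<and> h < d \<longrightarrow> norm (integral {x..x + h} f /\<^sub>R h - f x) < e"
    using integrable_ccontinuous_explicit[of f] f by (auto simp: cbox_interval)
  \<comment> \<open>The library's result concerns right derivatives only; reflection supplies the left ones.\<close>
  have "(\<lambda>x. f (- x)) integrable_on cbox a b" for a b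
    using Henstock_Kurzweil_Integration.integrable_reflect_real[of f "-a" "-b"] f by simp
  then obtain N2 where N2: "negligible N2"
    and left: "\<And>x e. x \<notin> N2 \<Longrightarrow> 0 < e \<Longrightarrow>
      \<exists>d>0. \<forall>h. 0 < h \<and> h < d \<longrightarrow> norm (integral {x..x + h} (\<lambda>x. f (- x)) /\<^sub>R h - f (- x)) < e"
    using integrable_ccontinuous_explicit[of "\<lambda>x. f (- x)"] by (auto simp: cbox_interval)
  have "negligible (N1 \<union> uminus ` N2)"
    using N1 N2 by (auto intro!: negligible_Un negligible_differentiable_image_negligible derivative_intros simp: differentiable_on_def)
  moreover have "((\<lambda>t. integral {a..t} f) has_real_derivative f x) (at x within {a..})"
    if x: "x \<notin> N1 \<union> uminus ` N2" and ax: "a \<le> x" for x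
    unfolding has_field_derivative_def has_derivative_within_alt
  proof (intro conjI allI impI)
    show "bounded_linear ((*) (f x))"
      by (rule bounded_linear_mult_right)
    fix e :: real
    assume "e > 0"
    have "- x \<notin> N2"
      using x by force
    obtain d1 where d1: "d1 > 0"
      "\<And>h. 0 < h \<Longrightarrow> h < d1 \<Longrightarrow> norm (integral {x..x + h} f /\<^sub>R h - f x) < e"
      using right[of x e] x \<open>e > 0\<close> by auto
    obtain d2 where d2: "d2 > 0"
      "\<And>h. 0 < h \<Longrightarrow> h < d2 \<Longrightarrow> norm (integral {- x..- x + h} (\<lambda>x. f (- x)) /\<^sub>R h - f x) < e"
      using left[OF \<open>- x \<notin> N2\<close> \<open>e > 0\<close>] by auto
    have scale: "\<bar>I - c * h\<bar> \<le> e * h" if "norm (I /\<^sub>R h - c) < e" "h > 0" for I c h :: real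
    proof -
      have "I - c * h = (I /\<^sub>R h - c) * h"
        using that(2) by (simp add: field_simps)
      then have "\<bar>I - c * h\<bar> = norm (I /\<^sub>R h - c) * h"
        using that(2) by (simp add: abs_mult)
      then show ?thesis
        using that by simp
    qed
    show "\<exists>\<delta>>0. \<forall>y\<in>{a..}. norm (y - x) < \<delta> \<longrightarrow>
        norm (integral {a..y} f - integral {a..x} f - f x * (y - x)) \<le> e * norm (y - x)"
    proof (intro exI[of _ "min d1 d2"] conjI ballI impI)
      fix y
      assume y: "y \<in> {a..}" "norm (y - x) < min d1 d2"
      consider "y = x" | "y > x" | "y < x" by linarith
      then show "norm (integral {a..y} f - integral {a..x} f - f x * (y - x)) \<le> e * norm (y - x)"
      proof cases
        case 2
        then have "integral {a..y} f - integral {a..x} f = integral {x..x + (y - x)} f"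
          using Henstock_Kurzweil_Integration.integral_combine[of a x y f] f ax by simp
        then show ?thesis
          using scale[OF d1(2)[of "y - x"]] y 2 by simp
      next
        case 3
        have "integral {a..y} f - integral {a..x} f = - integral {y..x} f"
          using Henstock_Kurzweil_Integration.integral_combine[of a y x f] f y 3 by simp
        \<comment> \<open>Reflection turns the interval to the left of \<open>x\<close> into one to
          the right of \<open>- x\<close>, where \<open>d2\<close> applies.\<close>
        also have "integral {y..x} f = integral {- x..- x + (x - y)} (\<lambda>x. f (- x))"
          using Henstock_Kurzweil_Integration.integral_reflect_real[of x y f] by simp
        finally show ?thesis
          using scale[OF d2(2)[of "x - y"]] y 3 by (simp add: algebra_simps abs_minus_commute)
      qed simp
    qed (use d1 d2 in auto)
  qed
  ultimately show ?thesis
    using that by blast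
qed

section \<open>Bochner integrals in nonseparable spaces\<close>

text \<open>In a nonseparable space the difference of two Borel functions may fail to be Borel. Here
  \<open>s\<close> takes finitely many values, and on each of its level sets the subtrahend is
  constant.\<close>

lemma borel_measurable_norm_diff_simple_function:
  fixes g :: "'b \<Rightarrow> 'a::real_normed_vector"
  assumes g: "g \<in> borel_measurable M" and s: "simple_function M s"
  shows "(\<lambda>x. norm (g x - s x)) \<in> borel_measurable M"
proof (rule measurable_compose_countable'[where g = s and I = "s ` space M" and f = "\<lambda>y x. norm (g x - y)"])
  show "(\<lambda>x. norm (g x - y)) \<in> borel_measurable M" for y
    by (rule measurable_compose[OF g]) (intro borel_measurable_continuous_onI continuous_intros)
  show "s \<in> M \<rightarrow>\<^sub>M count_space (s ` space M)" "countable (s ` space M)"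
    using s by (auto simp: simple_function_def measurable_count_space_eq2 countable_finite)
qed

text \<open>Applying the functional to the approximating simple functions gives real simple
  functions, and by Cauchy-Schwarz the error in mean grows at most by the factor
  \<open>norm e\<close>.\<close>

lemma has_Bochner_integral_inner:
  fixes g :: "'b \<Rightarrow> 'a::real_inner"
  assumes "has_Bochner_integral M g I"
  shows "has_bochner_integral M (\<lambda>x. g x \<bullet> e) (I \<bullet> e)"
proof -
  obtain s where g: "g \<in> borel_measurable M"
    and s: "\<And>i. Bochner_Integration.simple_bochner_integrable M (s i)"
    and lim: "(\<lambda>i. \<integral>\<^sup>+x. norm (g x - s i x) \<partial>M) \<longlonglongrightarrow> 0"
    and I: "(\<lambda>i. Bochner_Integration.simple_bochner_integral M (s i)) \<longlonglongrightarrow> I"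
    using assms unfolding has_Bochner_integral_def by blast
  show ?thesis
  proof (rule has_bochner_integral.intros)
    show "(\<lambda>x. g x \<bullet> e) \<in> borel_measurable M"
      by (rule measurable_compose[OF g]) (intro borel_measurable_continuous_onI continuous_intros)
    show "Bochner_Integration.simple_bochner_integrable M (\<lambda>x. s i x \<bullet> e)" for i
      using simple_bochner_integrable_compose2[OF _ s s, of "\<lambda>x y. x \<bullet> e"] by simp
    have "linear (\<lambda>x. x \<bullet> e)"
      by (rule bounded_linear.linear[OF bounded_linear_inner_left])
    from simple_bochner_integral_linear[OF this s]
    show "(\<lambda>i. Bochner_Integration.simple_bochner_integral M (\<lambda>x. s i x \<bullet> e)) \<longlonglongrightarrow> I \<bullet> e"
      using tendsto_inner[OF I tendsto_const] by simp
    have "(\<integral>\<^sup>+x. norm (g x \<bullet> e - s i x \<bullet> e) \<partial>M) \<le> ennreal (norm e) * (\<integral>\<^sup>+x. norm (g x - s i x) \<partial>M)" for i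
    proof -
      have "(\<integral>\<^sup>+x. norm (g x \<bullet> e - s i x \<bullet> e) \<partial>M) \<le> (\<integral>\<^sup>+x. ennreal (norm e) * norm (g x - s i x) \<partial>M)"
        using Cauchy_Schwarz_ineq2[of "g _ - s i _" e]
        by (intro nn_integral_mono)
          (simp add: mult.commute[of "norm e"] ennreal_leI flip: inner_diff_left ennreal_mult)
      also have "\<dots> = ennreal (norm e) * (\<integral>\<^sup>+x. norm (g x - s i x) \<partial>M)"
        using borel_measurable_norm_diff_simple_function[OF g] s[of i]
        by (intro nn_integral_cmult) (auto elim: simple_bochner_integrable.cases)
      finally show ?thesis .
    qed
    moreover have "(\<lambda>i. ennreal (norm e) * (\<integral>\<^sup>+x. norm (g x - s i x) \<partial>M)) \<longlonglongrightarrow> 0"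
      using ennreal_tendsto_cmult[OF _ lim, of "ennreal (norm e)"] by simp
    ultimately show "(\<lambda>i. \<integral>\<^sup>+x. norm (g x \<bullet> e - s i x \<bullet> e) \<partial>M) \<longlonglongrightarrow> 0"
      by - (rule tendsto_sandwich[OF _ _ tendsto_const, rotated 2], auto intro: always_eventually)
  qed
qed

text \<open>A single simple function at distance less than 1 in mean suffices: by the triangle
  inequality the norm of \<open>g\<close> is at most the error plus the norm of that
  function.\<close>

lemma has_Bochner_integral_integrable_norm:
  fixes g :: "'b \<Rightarrow> 'a::real_normed_vector"
  assumes "has_Bochner_integral M g I"
  shows "integrable M (\<lambda>x. norm (g x))"
proof -
  obtain s where g: "g \<in> borel_measurable M"
    and s: "\<And>i. Bochner_Integration.simple_bochner_integrable M (s i)"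
    and lim: "(\<lambda>i. \<integral>\<^sup>+x. norm (g x - s i x) \<partial>M) \<longlonglongrightarrow> 0"
    using assms unfolding has_Bochner_integral_def by blast
  have simple: "simple_function M (s i)" for i
    using s[of i] by (auto elim: simple_bochner_integrable.cases)
  obtain i where i: "(\<integral>\<^sup>+x. norm (g x - s i x) \<partial>M) < 1"
    using order_tendstoD(2)[OF lim, of 1] by (auto simp: eventually_sequentially)
  have si: "Bochner_Integration.simple_bochner_integrable M (\<lambda>x. norm (s i x))"
    using simple_bochner_integrable_compose2[OF _ s s, of "\<lambda>x y. norm x"] by simp
  have "(\<integral>\<^sup>+x. norm (g x) \<partial>M) \<le> (\<integral>\<^sup>+x. ennreal (norm (g x - s i x)) + norm (s i x) \<partial>M)"
    using norm_triangle_sub[of "g _" "s i _"]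
    by (intro nn_integral_mono) (simp add: add.commute flip: ennreal_plus)
  also have "\<dots> = (\<integral>\<^sup>+x. norm (g x - s i x) \<partial>M) + (\<integral>\<^sup>+x. norm (s i x) \<partial>M)"
    using borel_measurable_norm_diff_simple_function[OF g simple]
    by (intro nn_integral_add) (auto intro: borel_measurable_simple_function simple_function_compose1 simple)
  also have "\<dots> < \<infinity>"
    using i simple_bochner_integral_eq_nn_integral[OF si]
    by (auto simp: less_top order_less_trans[OF _ ennreal_one_less_top] simp flip: less_top)
  finally show ?thesis
    using measurable_compose[OF g borel_measurable_norm]
    by (intro integrableI_bounded) (auto simp: o_def)
qed

text \<open>On a space of finite measure uniform convergence implies convergence in mean. The
  integrals of the simple functions then form a Cauchy sequence, and completeness provides the
  value.\<close>

lemma Bochner_integrable_uniform_limit: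
  fixes g :: "'b \<Rightarrow> 'a::{real_normed_vector, complete_space}"
  assumes fin: "emeasure M (space M) < \<infinity>"
    and s: "\<And>n. simple_function M (s n)"
    and lim: "uniform_limit (space M) s g sequentially"
  shows "Bochner_integrable M g"
proof -
  define m where "m = measure M (space M)"
  have m: "emeasure M (space M) = ennreal m" "m \<ge> 0"
    using fin by (auto simp: m_def emeasure_eq_ennreal_measure)
  have sb: "Bochner_Integration.simple_bochner_integrable M (s i)" for i
  proof
    have "emeasure M {y \<in> space M. s i y \<noteq> 0} \<le> emeasure M (space M)"
      by (rule emeasure_mono) auto
    then show "emeasure M {y \<in> space M. s i y \<noteq> 0} \<noteq> \<infinity>"
      using fin by (auto simp: top_unique)
  qed (rule s)
  \<comment> \<open>A pointwise error of \<open>e / (m + 1)\<close> integrates to at most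
    \<open>e\<close> over total mass \<open>m\<close>, also when \<open>m = 0\<close>.\<close>
  have near: "\<forall>\<^sub>F n in sequentially. \<forall>x\<in>space M. norm (g x - s n x) \<le> e / (m + 1)" if "e > 0" for e
    using uniform_limitD[OF lim, of "e / (m + 1)"] that m
    by (auto simp: dist_norm norm_minus_commute elim!: eventually_mono intro: less_imp_le)
  have nn_le: "(\<integral>\<^sup>+x. ennreal (f x) \<partial>M) \<le> ennreal e"
    if "\<And>x. x \<in> space M \<Longrightarrow> f x \<le> e / (m + 1)" "e > 0" for f :: "'b \<Rightarrow> real" and e
  proof -
    have "(\<integral>\<^sup>+x. ennreal (f x) \<partial>M) \<le> (\<integral>\<^sup>+x. ennreal (e / (m + 1)) \<partial>M)"
      using that by (intro nn_integral_mono ennreal_leI)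
    also have "\<dots> = ennreal (e / (m + 1) * m)"
      using m that by (simp flip: ennreal_mult)
    also have "\<dots> \<le> ennreal e"
      using m that by (intro ennreal_leI) (simp add: field_simps)
    finally show ?thesis .
  qed
  have "Cauchy (\<lambda>i. Bochner_Integration.simple_bochner_integral M (s i))"
  proof (rule CauchyI)
    fix e :: real
    assume "e > 0"
    obtain N where N: "\<And>n x. n \<ge> N \<Longrightarrow> x \<in> space M \<Longrightarrow> norm (g x - s n x) \<le> (e / 4) / (m + 1)"
      using near[of "e / 4"] \<open>e > 0\<close> by (auto simp: eventually_sequentially)
    have "norm (Bochner_Integration.simple_bochner_integral M (s i) - Bochner_Integration.simple_bochner_integral M (s j)) < e"
      if "i \<ge> N" "j \<ge> N" for i j
    proof -
      have diff: "Bochner_Integration.simple_bochner_integrable M (\<lambda>x. s i x - s j x)"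
        by (rule simple_bochner_integrable_compose2[OF _ sb sb]) simp
      have nrm: "Bochner_Integration.simple_bochner_integrable M (\<lambda>x. norm (s i x - s j x))"
        by (rule simple_bochner_integrable_compose2[OF _ sb sb]) simp
      have "norm (Bochner_Integration.simple_bochner_integral M (s i) - Bochner_Integration.simple_bochner_integral M (s j))
          \<le> Bochner_Integration.simple_bochner_integral M (\<lambda>x. norm (s i x - s j x))"
        using simple_bochner_integral_norm_bound[OF diff] by (simp add: simple_bochner_integral_diff sb)
      also have "\<dots> \<le> e / 2"
      proof -
        have "ennreal (Bochner_Integration.simple_bochner_integral M (\<lambda>x. norm (s i x - s j x)))
            = (\<integral>\<^sup>+x. ennreal (norm (s i x - s j x)) \<partial>M)"
          by (rule simple_bochner_integral_eq_nn_integral[OF nrm]) simp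
        also have "\<dots> \<le> ennreal (e / 2)"
        proof (rule nn_le)
          fix x
          assume "x \<in> space M"
          then have "norm (g x - s i x) \<le> (e / 4) / (m + 1)" "norm (g x - s j x) \<le> (e / 4) / (m + 1)"
            using N that by auto
          moreover have "norm (s i x - s j x) \<le> norm (g x - s i x) + norm (g x - s j x)"
            using norm_triangle_ineq4[of "g x - s j x" "g x - s i x"] by simp
          moreover have "(e / 4) / (m + 1) + (e / 4) / (m + 1) = (e / 2) / (m + 1)"
            using m by (simp add: divide_simps)
          ultimately show "norm (s i x - s j x) \<le> (e / 2) / (m + 1)"
            by linarith
        qed (use \<open>e > 0\<close> in simp)
        finally show ?thesis
          using \<open>e > 0\<close> by (simp add: ennreal_le_iff)
      qed
      finally show ?thesis
        using \<open>e > 0\<close> by simp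
    qed
    then show "\<exists>N. \<forall>i\<ge>N. \<forall>j\<ge>N. norm (Bochner_Integration.simple_bochner_integral M (s i)
        - Bochner_Integration.simple_bochner_integral M (s j)) < e"
      by blast
  qed
  then obtain I where "(\<lambda>i. Bochner_Integration.simple_bochner_integral M (s i)) \<longlonglongrightarrow> I"
    using Cauchy_convergent convergent_def by blast
  moreover have "g \<in> borel_measurable M"
    by (rule borel_measurable_LIMSEQ_metric[of s])
      (auto intro: borel_measurable_simple_function s tendsto_uniform_limitI[OF lim])
  moreover have "(\<lambda>i. \<integral>\<^sup>+x. norm (g x - s i x) \<partial>M) \<longlonglongrightarrow> 0"
  proof (rule order_tendstoI)
    fix a :: ennreal
    assume "0 < a"
    \<comment> \<open>Since \<open>a\<close> may be infinite, a finite \<open>c\<close> below it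
      serves as the real error bound.\<close>
    then obtain c where c: "0 < c" "c < a"
      using dense by blast
    then have "c < top"
      by (auto intro: less_le_trans)
    with c have e: "enn2real c > 0" "ennreal (enn2real c) < a"
      by (auto simp: enn2real_positive_iff)
    show "\<forall>\<^sub>F i in sequentially. (\<integral>\<^sup>+x. norm (g x - s i x) \<partial>M) < a"
      using near[OF e(1)] by eventually_elim (rule le_less_trans[OF nn_le[OF _ e(1)] e(2)], blast)
  qed auto
  ultimately show ?thesis
    unfolding Bochner_integrable_def has_Bochner_integral_def using sb by blast
qed

section \<open>Uniform approximation by rounding to a grid\<close>

lemma simple_function_floor:
  fixes f :: "'b \<Rightarrow> real"
  assumes f[measurable]: "f \<in> borel_measurable M" and bnd: "\<And>x. x \<in> space M \<Longrightarrow> f x \<in> {A..B}"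
  shows "simple_function M (\<lambda>x. \<lfloor>f x\<rfloor>)"
  unfolding simple_function_eq_measurable
proof
  have "(\<lambda>x. \<lfloor>f x\<rfloor>) ` space M \<subseteq> {\<lfloor>A\<rfloor>..\<lfloor>B\<rfloor>}"
    by (auto intro!: floor_mono dest: bnd)
  then show "finite ((\<lambda>x. \<lfloor>f x\<rfloor>) ` space M)"
    by (rule finite_subset) simp
  show "(\<lambda>x. \<lfloor>f x\<rfloor>) \<in> M \<rightarrow>\<^sub>M count_space UNIV"
    by measurable
qed

lemma uniform_limit_floor:
  fixes f :: "'b \<Rightarrow> real"
  shows "uniform_limit S (\<lambda>n x. of_int \<lfloor>real (Suc n) * f x\<rfloor> / real (Suc n)) f sequentially"
proof (rule uniform_limitI)
  fix e :: real
  assume "e > 0"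
  have "\<bar>of_int \<lfloor>real (Suc n) * f x\<rfloor> / real (Suc n) - f x\<bar> \<le> inverse (real (Suc n))" for n x
  proof -
    have "\<bar>of_int \<lfloor>real (Suc n) * f x\<rfloor> - real (Suc n) * f x\<bar> \<le> 1"
      by linarith
    then have "\<bar>of_int \<lfloor>real (Suc n) * f x\<rfloor> - real (Suc n) * f x\<bar> / real (Suc n) \<le> 1 / real (Suc n)"
      by (rule divide_right_mono) simp
    moreover have "of_int \<lfloor>real (Suc n) * f x\<rfloor> / real (Suc n) - f x
        = (of_int \<lfloor>real (Suc n) * f x\<rfloor> - real (Suc n) * f x) / real (Suc n)"
      by (simp add: field_simps del: of_nat_Suc)
    ultimately show ?thesis
      by (simp add: inverse_eq_divide abs_divide del: of_nat_Suc)
  qed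
  moreover have "\<forall>\<^sub>F n in sequentially. inverse (real (Suc n)) < e"
    using LIMSEQ_inverse_real_of_nat \<open>e > 0\<close> by (rule order_tendstoD(2))
  ultimately show "\<forall>\<^sub>F n in sequentially. \<forall>x\<in>S. dist (of_int \<lfloor>real (Suc n) * f x\<rfloor> / real (Suc n)) (f x) < e"
    by (auto simp: dist_real_def elim!: eventually_mono intro: le_less_trans)
qed

text \<open>Both factors are discretised: the values of \<open>lam\<close> are rounded, and
  \<open>w\<close> is sampled at rounded arguments. The samples converge uniformly because
  \<open>w\<close> is uniformly continuous on the compact interval, and the products because both
  factors are bounded.\<close>

lemma Bochner_integrable_scaleR_continuous:
  fixes w :: "real \<Rightarrow> 'a::{real_normed_vector, complete_space}"
  assumes lam: "lam \<in> borel_measurable (lebesgue_on {0..b})" and bnd: "\<And>t. t \<in> {0..b} \<Longrightarrow> lam t \<in> {A..B}"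
    and w: "continuous_on {0..b} w"
  shows "Bochner_integrable (lebesgue_on {0..b}) (\<lambda>s. lam s *\<^sub>R w s)"
proof -
  define M where "M = lebesgue_on {0..b}"
  have space_M: "space M = {0..b}"
    by (simp add: M_def)
  \<comment> \<open>Rounding down, with \<open>0\<close> on every grid, keeps the sample points
    inside \<open>{0..b}\<close>, where \<open>w\<close> is known to be continuous.\<close>
  define fl where "fl = (\<lambda>n x. of_int \<lfloor>real (Suc n) * x\<rfloor> / real (Suc n))"
  have fl_in: "fl n x \<in> {0..b}" if "x \<in> {0..b}" for n x
  proof -
    have "of_int \<lfloor>real (Suc n) * x\<rfloor> \<le> real (Suc n) * x"
      by (rule of_int_floor_le)
    then have "fl n x \<le> x"
      by (simp add: fl_def field_simps)
    moreover have "0 \<le> fl n x"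
      using that by (simp add: fl_def)
    ultimately show ?thesis
      using that by simp
  qed
  have simple_fl: "simple_function M (\<lambda>x. fl n (f x))"
    if "f \<in> borel_measurable M" "\<And>x. x \<in> space M \<Longrightarrow> f x \<in> {C..D}" for f n C D
    unfolding fl_def using that
    by (intro simple_function_compose1[where g = "\<lambda>z. of_int z / real (Suc n)"]
        simple_function_floor[where A = "real (Suc n) * C" and B = "real (Suc n) * D"])
      (auto intro!: mult_left_mono simp del: of_nat_Suc)
  show ?thesis
    unfolding M_def[symmetric]
  proof (rule Bochner_integrable_uniform_limit)
    show "emeasure M (space M) < \<infinity>"
      by (simp add: M_def emeasure_restrict_space emeasure_lborel_Icc_eq)
    show "simple_function M (\<lambda>s. fl n (lam s) *\<^sub>R w (fl n s))" for n
    proof (rule simple_function_compose2[where h = "\<lambda>c x. c *\<^sub>R w x"])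
      show "simple_function M (\<lambda>s. fl n (lam s))"
        using lam bnd by (intro simple_fl) (auto simp: M_def)
      show "simple_function M (\<lambda>s. fl n s)"
        by (rule simple_fl[where C = 0 and D = b])
          (auto simp: M_def intro!: measurable_restrict_space1 measurable_completion)
    qed
    have ulim_w: "uniform_limit (space M) (\<lambda>n s. w (fl n s)) w sequentially"
      unfolding space_M
      by (rule uniform_limit_compose_uniformly_continuous_on[OF _ _ _ closed_atLeastAtMost[of 0 b]])
        (use uniform_limit_floor[of "\<lambda>x. x" "{0..b}"] fl_in w in
          \<open>auto simp: fl_def intro: compact_uniformly_continuous\<close>)
    have "bounded (lam ` space M)"
      by (rule bounded_subset[OF bounded_closed_interval[of A B]]) (auto simp: space_M dest: bnd)
    moreover have "bounded (w ` space M)"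
      using w by (auto simp: space_M intro: compact_imp_bounded compact_continuous_image)
    ultimately show "uniform_limit (space M) (\<lambda>n s. fl n (lam s) *\<^sub>R w (fl n s)) (\<lambda>s. lam s *\<^sub>R w s) sequentially"
      using uniform_limit_floor[of lam "space M"]
      by (intro uniform_limit_intros ulim_w) (auto simp: fl_def)
  qed
qed

section \<open>Weak integrals\<close>

text \<open>Testing against vectors reduces integrals to real ones. The library's vector-valued
  integrals do not apply here: Bochner's requires a second countable space, and Henstock's requires the
  class \<open>banach\<close>, which the sort \<open>{real_inner, complete_space}\<close> does not entail.\<close>

definition has_weak_integral :: "(real \<Rightarrow> 'a::real_inner) \<Rightarrow> 'a \<Rightarrow> real set \<Rightarrow> bool" where
  "has_weak_integral g I S \<longleftrightarrow> (\<forall>e. ((\<lambda>s. g s \<bullet> e) has_integral (I \<bullet> e)) S)"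

lemma has_Bochner_integral_imp_has_weak_integral:
  fixes g :: "real \<Rightarrow> 'a::real_inner"
  assumes "has_Bochner_integral (lebesgue_on {a..b}) g I"
  shows "has_weak_integral g I {a..b}"
  unfolding has_weak_integral_def
proof
  fix e
  have "integrable (lebesgue_on {a..b}) (\<lambda>s. g s \<bullet> e)" "integral\<^sup>L (lebesgue_on {a..b}) (\<lambda>s. g s \<bullet> e) = I \<bullet> e"
    using has_Bochner_integral_inner[OF assms, of e] by (auto simp: has_bochner_integral_iff)
  then show "((\<lambda>s. g s \<bullet> e) has_integral I \<bullet> e) {a..b}"
    using has_integral_integral_lebesgue_on[of "{a..b}" "\<lambda>s. g s \<bullet> e"] by simp
qed

lemma has_weak_integral_diff:
  assumes "has_weak_integral f I S" "has_weak_integral g J S"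
  shows "has_weak_integral (\<lambda>s. f s - g s) (I - J) S"
  using assms unfolding has_weak_integral_def by (auto simp: inner_diff_left intro: has_integral_diff)

lemma has_weak_integral_scaleR_left:
  assumes "(k has_integral c) S"
  shows "has_weak_integral (\<lambda>s. k s *\<^sub>R w) (c *\<^sub>R w) S"
  using assms unfolding has_weak_integral_def by (auto intro: has_integral_mult_left)

lemma has_weak_integral_combine_diff:
  fixes g :: "real \<Rightarrow> 'a::real_inner"
  assumes "a \<le> u" "u \<le> v" and I: "has_weak_integral g I {a..u}" and J: "has_weak_integral g J {a..v}"
  shows "has_weak_integral g (J - I) {u..v}"
  unfolding has_weak_integral_def
proof
  fix e
  have I: "((\<lambda>s. g s \<bullet> e) has_integral I \<bullet> e) {a..u}" and J: "((\<lambda>s. g s \<bullet> e) has_integral J \<bullet> e) {a..v}"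
    using I J by (auto simp: has_weak_integral_def)
  have "(\<lambda>s. g s \<bullet> e) integrable_on {u..v}"
    using integrable_on_subinterval[of "\<lambda>s. g s \<bullet> e" "{a..v}" u v] J assms by (auto simp: integrable_on_def)
  then obtain c where c: "((\<lambda>s. g s \<bullet> e) has_integral c) {u..v}"
    by (auto simp: integrable_on_def)
  have "c = (J - I) \<bullet> e"
    using has_integral_unique[OF has_integral_combine[OF assms(1,2) I c] J] by (simp add: inner_diff_left)
  with c show "((\<lambda>s. g s \<bullet> e) has_integral (J - I) \<bullet> e) {u..v}"
    by simp
qed

text \<open>Testing against \<open>I\<close> itself bounds the square of \<open>norm I\<close> by
  \<open>integral S k * norm I\<close>; then one factor \<open>norm I\<close> cancels.\<close>

lemma norm_has_weak_integral_le:
  fixes g :: "real \<Rightarrow> 'a::real_inner"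
  assumes I: "has_weak_integral g I S" and k: "k integrable_on S"
    and le: "\<And>s. s \<in> S \<Longrightarrow> norm (g s) \<le> k s"
  shows "norm I \<le> integral S k"
proof -
  have "I \<bullet> I \<le> integral S k * norm I"
  proof (rule has_integral_le)
    show "((\<lambda>s. g s \<bullet> I) has_integral I \<bullet> I) S"
      using I by (simp add: has_weak_integral_def)
    show "((\<lambda>s. k s * norm I) has_integral integral S k * norm I) S"
      using k by (intro has_integral_mult_left integrable_integral)
    show "g s \<bullet> I \<le> k s * norm I" if "s \<in> S" for s
      using norm_cauchy_schwarz[of "g s" I] mult_right_mono[OF le[OF that] norm_ge_zero[of I]] by simp
  qed
  then have "norm I * norm I \<le> integral S k * norm I"
    by (simp add: dot_square_norm power2_eq_square)
  moreover have "integral S k \<ge> 0"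
    using le by (intro integral_nonneg k) (meson norm_ge_zero order_trans)
  ultimately show ?thesis
    by (cases "I = 0") (auto simp: mult_le_cancel_right)
qed

lemma has_Bochner_integral_increment_le:
  fixes g :: "real \<Rightarrow> 'a::real_inner"
  assumes "has_Bochner_integral (lebesgue_on {a..u}) g I" "has_Bochner_integral (lebesgue_on {a..v}) g J"
    and "a \<le> u" "u \<le> v"
  shows "norm (J - I) \<le> integral {u..v} (\<lambda>s. norm (g s))"
proof (rule norm_has_weak_integral_le)
  show "has_weak_integral g (J - I) {u..v}"
    using assms by (intro has_weak_integral_combine_diff[of a] has_Bochner_integral_imp_has_weak_integral)
  have "(\<lambda>s. norm (g s)) integrable_on {a..v}"
    using has_Bochner_integral_integrable_norm[OF assms(2)] by (rule integrable_on_lebesgue_on) simp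
  then show "(\<lambda>s. norm (g s)) integrable_on {u..v}"
    using assms by (auto intro: integrable_on_subinterval)
qed simp

section \<open>Existence\<close>

text \<open>The bounds hold on the whole line, so that intervals need no side conditions. A rate
  given only on \<open>{0..}\<close> enters through its extension by zero.\<close>

locale bounded_rate =
  fixes lam :: "real \<Rightarrow> real"
  assumes rate_measurable: "lam \<in> borel_measurable lebesgue"
    and rate_nonneg: "0 \<le> lam t" and rate_le_1: "lam t \<le> 1"
begin

lemma rate_integrable: "lam integrable_on {a..b}"
proof -
  have "lam absolutely_integrable_on {a..b}"
    using rate_nonneg rate_le_1
    by (intro measurable_bounded_by_integrable_imp_absolutely_integrable[where g = "\<lambda>_. 1"])
      (auto intro: measurable_restrict_space1 rate_measurable)
  then show ?thesis
    by (rule set_lebesgue_integral_eq_integral(1))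
qed

lemma ex_primitive:
  fixes w :: "real \<Rightarrow> 'a::{real_normed_vector, complete_space}"
  assumes "continuous_on {0..} w"
  shows "\<exists>J. \<forall>t\<ge>0. has_Bochner_integral (lebesgue_on {0..t}) (\<lambda>s. lam s *\<^sub>R w s) (J t)"
proof -
  have "Bochner_integrable (lebesgue_on {0..t}) (\<lambda>s. lam s *\<^sub>R w s)" for t
    using rate_nonneg rate_le_1 rate_measurable assms
    by (intro Bochner_integrable_scaleR_continuous[where A = 0 and B = 1])
      (auto intro: measurable_restrict_space1 continuous_on_subset)
  then show ?thesis
    unfolding Bochner_integrable_def by metis
qed

text \<open>Replacing \<open>w\<close> by the constant \<open>W\<close> leaves the integrand
  \<open>lam s *\<^sub>R (w s - W)\<close>, of norm at most \<open>e\<close> because the rate lies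
  between 0 and 1. The choice \<open>W = 0\<close> yields local Lipschitz continuity of the
  primitive, and \<open>W = w t\<close> its derivative at \<open>t\<close>.\<close>

lemma primitive_increment_le:
  fixes w :: "real \<Rightarrow> 'a::real_inner"
  assumes J: "\<And>t. 0 \<le> t \<Longrightarrow> has_weak_integral (\<lambda>s. lam s *\<^sub>R w s) (J t) {0..t}"
    and uv: "0 \<le> u" "u \<le> v" and le: "\<And>s. s \<in> {u..v} \<Longrightarrow> norm (w s - W) \<le> e"
  shows "norm (J v - J u - integral {u..v} lam *\<^sub>R W) \<le> e * (v - u)"
proof -
  have "has_weak_integral (\<lambda>s. lam s *\<^sub>R w s - lam s *\<^sub>R W) (J v - J u - integral {u..v} lam *\<^sub>R W) {u..v}"
    using uv J by (intro has_weak_integral_diff has_weak_integral_scaleR_left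
        has_weak_integral_combine_diff[of 0] integrable_integral rate_integrable) auto
  moreover have "norm (lam s *\<^sub>R w s - lam s *\<^sub>R W) \<le> e" if "s \<in> {u..v}" for s
  proof -
    have "norm (lam s *\<^sub>R w s - lam s *\<^sub>R W) = lam s * norm (w s - W)"
      using rate_nonneg by (simp flip: scaleR_diff_right)
    also have "\<dots> \<le> 1 * norm (w s - W)"
      by (intro mult_right_mono rate_le_1) simp
    finally show ?thesis
      using le[OF that] by simp
  qed
  ultimately have "norm (J v - J u - integral {u..v} lam *\<^sub>R W) \<le> integral {u..v} (\<lambda>_. e)"
    by (intro norm_has_weak_integral_le) auto
  then show ?thesis
    using uv by (simp add: mult.commute)
qed

lemma continuous_on_primitive:
  fixes w :: "real \<Rightarrow> 'a::real_inner"
  assumes J: "\<And>t. 0 \<le> t \<Longrightarrow> has_weak_integral (\<lambda>s. lam s *\<^sub>R w s) (J t) {0..t}"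
    and w: "continuous_on {0..} w"
  shows "continuous_on {0..} J"
  unfolding continuous_on_eq_continuous_within
proof
  fix t :: real
  assume t: "t \<in> {0..}"
  \<comment> \<open>The interval reaches beyond \<open>t\<close> so that it is a neighbourhood of
    \<open>t\<close> relative to \<open>{0..}\<close>.\<close>
  have "bounded (w ` {0..t + 1})"
    using w by (intro compact_imp_bounded compact_continuous_image) (auto intro: continuous_on_subset)
  then obtain B where "\<And>s. s \<in> {0..t + 1} \<Longrightarrow> norm (w s) \<le> B"
    unfolding bounded_iff by blast
  then have le: "norm (J v - J u) \<le> B * (v - u)" if "0 \<le> u" "u \<le> v" "v \<le> t + 1" for u v
    using primitive_increment_le[OF J, of u v 0 B] that by simp
  have "B-lipschitz_on {0..t + 1} J"
  proof (rule lipschitz_onI)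
    show "dist (J u) (J v) \<le> B * dist u v" if "u \<in> {0..t + 1}" "v \<in> {0..t + 1}" for u v
      using le[of u v] le[of v u] that by (cases "u \<le> v") (auto simp: dist_norm norm_minus_commute)
    show "0 \<le> B"
      using order_trans[OF norm_ge_zero le[of t "t + 1"]] t by simp
  qed
  then have "continuous (at t within {0..t + 1}) J"
    using t by (auto dest!: lipschitz_on_continuous_on simp: continuous_on_eq_continuous_within)
  moreover have "at t within {0..} = at t within {0..t + 1}"
    by (rule at_within_nhd[where S = "{..<t + 1}"]) auto
  ultimately show "continuous (at t within {0..}) J"
    by simp
qed

text \<open>Two comparisons near \<open>t\<close>: the increment of \<open>J\<close> with that of
  the scalar primitive times \<open>w t\<close>, by continuity of \<open>w\<close>; then the scalar
  increment with \<open>lam t * (s - t)\<close>, by \<open>der\<close>. Each costs half of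
  \<open>e\<close>.\<close>

lemma primitive_has_vector_derivative:
  fixes w :: "real \<Rightarrow> 'a::real_inner"
  assumes J: "\<And>t. 0 \<le> t \<Longrightarrow> has_weak_integral (\<lambda>s. lam s *\<^sub>R w s) (J t) {0..t}"
    and w: "continuous_on {0..} w" and t: "0 \<le> t"
    and der: "((\<lambda>s. integral {0..s} lam) has_real_derivative lam t) (at t within {0..})"
  shows "(J has_vector_derivative lam t *\<^sub>R w t) (at t within {0..})"
  unfolding has_vector_derivative_def has_derivative_within_alt
proof (intro conjI allI impI)
  let ?L = "\<lambda>s. integral {0..s} lam"
  show "bounded_linear (\<lambda>h. h *\<^sub>R lam t *\<^sub>R w t)"
    by (rule bounded_linear_scaleR_left)
  fix e :: real
  assume "e > 0"
  \<comment> \<open>The scalar error is later multiplied by \<open>norm (w t)\<close>, which may be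
    zero; hence the \<open>+ 1\<close>.\<close>
  define \<eta> where "\<eta> = e / (2 * (norm (w t) + 1))"
  have pos: "norm (w t) + 1 > 0"
    using norm_ge_zero[of "w t"] by linarith
  have \<eta>: "\<eta> > 0" "\<eta> * norm (w t) \<le> e / 2"
    using \<open>e > 0\<close> pos by (auto simp: \<eta>_def field_simps)
  obtain \<delta>1 where \<delta>1: "\<delta>1 > 0" "\<And>s. 0 \<le> s \<Longrightarrow> \<bar>s - t\<bar> < \<delta>1 \<Longrightarrow> norm (w s - w t) \<le> e / 2"
  proof -
    obtain d where "d > 0" "\<forall>s\<in>{0..}. dist s t < d \<longrightarrow> dist (w s) (w t) < e / 2"
      using w t half_gt_zero[OF \<open>e > 0\<close>] unfolding continuous_on_iff by (metis atLeast_iff)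
    then show ?thesis
      by (intro that[of d]) (auto simp: dist_norm intro: less_imp_le)
  qed
  obtain \<delta>2 where \<delta>2: "\<delta>2 > 0"
    "\<And>s. s \<in> {0..} \<Longrightarrow> norm (s - t) < \<delta>2 \<Longrightarrow> norm (?L s - ?L t - lam t * (s - t)) \<le> \<eta> * norm (s - t)"
    using der \<eta>(1) unfolding has_field_derivative_def has_derivative_within_alt by blast
  show "\<exists>\<delta>>0. \<forall>s\<in>{0..}. norm (s - t) < \<delta> \<longrightarrow>
      norm (J s - J t - (s - t) *\<^sub>R lam t *\<^sub>R w t) \<le> e * norm (s - t)"
  proof (intro exI[of _ "min \<delta>1 \<delta>2"] conjI ballI impI)
    fix s :: real
    assume s: "s \<in> {0..}" "norm (s - t) < min \<delta>1 \<delta>2"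
    have combine: "?L v - ?L u = integral {u..v} lam" if "0 \<le> u" "u \<le> v" for u v
      using Henstock_Kurzweil_Integration.integral_combine[OF that rate_integrable] by simp
    have near: "norm (w r - w t) \<le> e / 2" if "r \<in> {min s t..max s t}" for r
      using that s t by (intro \<delta>1(2)) auto
    have 1: "norm (J s - J t - (?L s - ?L t) *\<^sub>R w t) \<le> e / 2 * norm (s - t)"
    proof (cases "t \<le> s")
      case True
      then show ?thesis
        using primitive_increment_le[OF J t True, of "w t" "e / 2"] near combine[OF t True] by simp
    next
      case False
      then have st: "0 \<le> s" "s \<le> t"
        using s by auto
      have "J s - J t - (?L s - ?L t) *\<^sub>R w t = - (J t - J s - integral {s..t} lam *\<^sub>R w t)"
        by (simp add: combine[OF st, symmetric] algebra_simps)
      then show ?thesis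
        using primitive_increment_le[OF J st, of "w t" "e / 2"] near False by (simp only: norm_minus_cancel) simp
    qed
    have "J s - J t - (s - t) *\<^sub>R lam t *\<^sub>R w t
        = (J s - J t - (?L s - ?L t) *\<^sub>R w t) + (?L s - ?L t - lam t * (s - t)) *\<^sub>R w t"
      by (simp add: algebra_simps)
    then have "norm (J s - J t - (s - t) *\<^sub>R lam t *\<^sub>R w t)
        \<le> norm (J s - J t - (?L s - ?L t) *\<^sub>R w t) + \<bar>?L s - ?L t - lam t * (s - t)\<bar> * norm (w t)"
      by (metis norm_triangle_ineq norm_scaleR)
    also have "\<dots> \<le> e / 2 * norm (s - t) + \<eta> * norm (s - t) * norm (w t)"
      using \<delta>2(2)[of s] s by (intro add_mono 1 mult_right_mono) auto
    also have "\<dots> \<le> e / 2 * norm (s - t) + e / 2 * norm (s - t)"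
      using mult_right_mono[OF \<eta>(2) norm_ge_zero[of "s - t"]] by (simp add: mult_ac)
    finally show "norm (J s - J t - (s - t) *\<^sub>R lam t *\<^sub>R w t) \<le> e * norm (s - t)"
      by (simp add: field_simps)
  qed (use \<delta>1 \<delta>2 in auto)
qed

end

section \<open>The fixed point in the exponentially weighted norm\<close>

text \<open>Integrating an exponential of rate \<open>\<kappa>\<close> gains a factor
  \<open>1 / \<kappa>\<close>. This gain makes the Picard map a contraction on the whole half-line
  at once, with no gluing of local solutions.\<close>

lemma exp_weighted_norm_weak_integral_le:
  fixes g :: "real \<Rightarrow> 'a::real_inner"
  assumes I: "has_weak_integral g I {0..t}" and t: "0 \<le> t" and k: "\<kappa> > 0" and C: "C \<ge> 0"
    and le: "\<And>s. s \<in> {0..t} \<Longrightarrow> norm (g s) \<le> C * exp (\<kappa> * s)"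
  shows "exp (- \<kappa> * t) * norm I \<le> C / \<kappa>"
proof -
  have int: "((\<lambda>s. C * exp (\<kappa> * s)) has_integral C / \<kappa> * exp (\<kappa> * t) - C / \<kappa> * exp (\<kappa> * 0)) {0..t}"
    using k t by (intro fundamental_theorem_of_calculus)
      (auto intro!: derivative_eq_intros simp flip: has_real_derivative_iff_has_vector_derivative)
  have "norm I \<le> C / \<kappa> * exp (\<kappa> * t) - C / \<kappa>"
    using norm_has_weak_integral_le[OF I has_integral_integrable[OF int] le] integral_unique[OF int] by simp
  also have "\<dots> \<le> C / \<kappa> * exp (\<kappa> * t)"
    using k C by simp
  finally have "exp (- \<kappa> * t) * norm I \<le> exp (- \<kappa> * t) * (C / \<kappa> * exp (\<kappa> * t))"
    by (rule mult_left_mono) simp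
  also have "\<dots> = C / \<kappa>"
    by (simp add: exp_minus field_simps)
  finally show ?thesis .
qed

lemma (in bounded_rate) ex_integral_equation_solution:
  fixes F :: "'a::{real_inner, complete_space} \<Rightarrow> 'a"
  assumes F: "L-lipschitz_on UNIV F"
  shows "\<exists>x. continuous_on {0..} x \<and>
    (\<forall>t\<ge>0. has_Bochner_integral (lebesgue_on {0..t}) (\<lambda>s. lam s *\<^sub>R F (x s)) (x t - x0))"
proof -
  have L: "L \<ge> 0" and F_le: "norm (F p - F q) \<le> L * norm (p - q)" for p q
    using F by (auto simp: lipschitz_on_def dist_norm)
  \<comment> \<open>Chosen so that the contraction factor \<open>L / \<kappa>\<close> is at most one
    half; the \<open>+ 1\<close> keeps \<open>\<kappa>\<close> positive when
    \<open>L = 0\<close>.\<close>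
  define \<kappa> where "\<kappa> = 2 * L + 1"
  have \<kappa>: "\<kappa> > 0" "L / \<kappa> \<le> 1 / 2"
    using L by (auto simp: \<kappa>_def field_simps)
  \<comment> \<open>The unknown is the bounded function \<open>u t = exp (- \<kappa> t) x t\<close>, so that the sup norm of \<open>u\<close> is the
    weighted norm of \<open>x\<close>.\<close>
  define W where "W = (\<lambda>(u :: real \<Rightarrow>\<^sub>C 'a) s. F (exp (\<kappa> * s) *\<^sub>R apply_bcontfun u s))"
  have W_cont: "continuous_on {0..} (W u)" for u
    unfolding W_def
    by (rule continuous_on_compose2[OF lipschitz_on_continuous_on[OF F]]) (auto intro!: continuous_intros)
  obtain J where J: "\<And>u t. t \<ge> 0 \<Longrightarrow> has_Bochner_integral (lebesgue_on {0..t}) (\<lambda>s. lam s *\<^sub>R W u s) (J u t)"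
    using ex_primitive[OF W_cont] by metis
  have J_weak: "has_weak_integral (\<lambda>s. lam s *\<^sub>R W u s) (J u t) {0..t}" if "t \<ge> 0" for u t
    using J[OF that] by (rule has_Bochner_integral_imp_has_weak_integral)
  have J_cont: "continuous_on {0..} (J u)" for u
    using J_weak W_cont by (rule continuous_on_primitive)
  have rate_le: "lam s * a \<le> b" if "0 \<le> a" "a \<le> b" for s a b
    using mult_mono[OF rate_le_1[of s] that(2)] that by simp
  \<comment> \<open>The Picard map written for \<open>u\<close>. Bounded continuous functions live
    on all of \<open>real\<close>, so \<open>max 0 t\<close> extends the image constantly to
    negative times.\<close>
  define P where "P = (\<lambda>u t. exp (- \<kappa> * max 0 t) *\<^sub>R (x0 + J u (max 0 t)))"
  have P_bcontfun: "P u \<in> bcontfun" for u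
  proof (rule bcontfun_normI)
    show "continuous_on UNIV (P u)"
      unfolding P_def
      by (intro continuous_intros continuous_on_compose2[OF J_cont]) auto
    \<comment> \<open>Linear growth of \<open>F\<close> gives
      \<open>norm (W u s) \<le> C * exp (\<kappa> * s)\<close>, since
      \<open>exp (\<kappa> * s)\<close> is at least 1 for \<open>s \<ge> 0\<close>.\<close>
    define C where "C = norm (F 0) + L * norm u"
    have "C \<ge> 0"
      using L by (simp add: C_def)
    fix t :: real
    define r where "r = max 0 t"
    have r: "r \<ge> 0" by (simp add: r_def)
    have "exp (- \<kappa> * r) * norm (J u r) \<le> C / \<kappa>"
    proof (rule exp_weighted_norm_weak_integral_le[OF J_weak[OF r] r \<kappa>(1) \<open>C \<ge> 0\<close>])
      fix s
      assume s: "s \<in> {0..r}"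
      have "norm (W u s) \<le> norm (F 0) + norm (W u s - F 0)"
        by (metis norm_triangle_sub)
      also have "\<dots> \<le> norm (F 0) + L * norm (exp (\<kappa> * s) *\<^sub>R apply_bcontfun u s)"
        using F_le[of "exp (\<kappa> * s) *\<^sub>R apply_bcontfun u s" 0] by (simp add: W_def)
      also have "\<dots> \<le> norm (F 0) * exp (\<kappa> * s) + L * (norm u * exp (\<kappa> * s))"
        using s \<kappa> L norm_bounded[of u s]
        by (intro add_mono mult_left_mono) (auto intro: mult_left_le simp: mult.commute mult_le_cancel_left1)
      finally have "norm (W u s) \<le> C * exp (\<kappa> * s)"
        by (simp add: C_def algebra_simps)
      then show "norm (lam s *\<^sub>R W u s) \<le> C * exp (\<kappa> * s)"
        using rate_nonneg[of s] by (simp add: rate_le)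
    qed
    moreover have "exp (- \<kappa> * r) * norm x0 \<le> 1 * norm x0"
      using \<kappa> r by (intro mult_right_mono) auto
    moreover have "norm (P u t) \<le> exp (- \<kappa> * r) * norm x0 + exp (- \<kappa> * r) * norm (J u r)"
      using mult_left_mono[OF norm_triangle_ineq[of x0 "J u r"], of "exp (- \<kappa> * r)"]
      by (simp add: P_def r_def distrib_left)
    ultimately show "norm (P u t) \<le> norm x0 + C / \<kappa>"
      by simp
  qed
  have contr: "dist (P u t) (P v t) \<le> 1 / 2 * dist u v" for u v t
  proof -
    define r where "r = max 0 t"
    have r: "r \<ge> 0" by (simp add: r_def)
    have "exp (- \<kappa> * r) * norm (J u r - J v r) \<le> L * dist u v / \<kappa>"
    proof (rule exp_weighted_norm_weak_integral_le[OF has_weak_integral_diff[OF J_weak[OF r] J_weak[OF r]] r \<kappa>(1)])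
      show "0 \<le> L * dist u v"
        using L by simp
      fix s
      assume s: "s \<in> {0..r}"
      have "norm (W u s - W v s) \<le> L * norm (exp (\<kappa> * s) *\<^sub>R (apply_bcontfun u s - apply_bcontfun v s))"
        using F_le by (simp add: W_def scaleR_diff_right)
      also have "\<dots> = L * (exp (\<kappa> * s) * dist (apply_bcontfun u s) (apply_bcontfun v s))"
        by (simp add: dist_norm)
      also have "\<dots> \<le> L * (exp (\<kappa> * s) * dist u v)"
        using L by (intro mult_left_mono dist_bounded) auto
      finally have "norm (W u s - W v s) \<le> L * dist u v * exp (\<kappa> * s)"
        by (simp add: mult_ac)
      then show "norm (lam s *\<^sub>R W u s - lam s *\<^sub>R W v s) \<le> L * dist u v * exp (\<kappa> * s)"
        using rate_nonneg[of s] by (simp add: rate_le flip: scaleR_diff_right)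
    qed
    also have "\<dots> = L / \<kappa> * dist u v"
      by simp
    also have "\<dots> \<le> 1 / 2 * dist u v"
      by (rule mult_right_mono[OF \<kappa>(2)]) simp
    finally show ?thesis
      by (simp add: P_def r_def dist_norm flip: scaleR_diff_right)
  qed
  have "\<exists>!u. Bcontfun (P u) = u"
  proof (rule banach_fix_type[of "1 / 2"])
    show "\<forall>u v. dist (Bcontfun (P u)) (Bcontfun (P v)) \<le> 1 / 2 * dist u v"
    proof (intro allI dist_bound)
      show "dist (apply_bcontfun (Bcontfun (P u)) t) (apply_bcontfun (Bcontfun (P v)) t) \<le> 1 / 2 * dist u v" for u v t
        unfolding Bcontfun_inverse[OF P_bcontfun] by (rule contr)
    qed
  qed auto
  then obtain u where "Bcontfun (P u) = u"
    by blast
  then have u: "apply_bcontfun u t = P u t" for t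
    using Bcontfun_inverse[OF P_bcontfun, of u] by metis
  define x where "x = (\<lambda>t. exp (\<kappa> * t) *\<^sub>R apply_bcontfun u t)"
  have x: "x t - x0 = J u t" if "t \<ge> 0" for t
    using that by (simp add: x_def u P_def exp_minus)
  have W: "W u s = F (x s)" for s
    by (simp add: W_def x_def)
  have "continuous_on {0..} x"
    unfolding x_def by (intro continuous_intros) auto
  then show ?thesis
    using J[of _ u] x W by auto
qed

text \<open>Nonexpansiveness makes \<open>T\<close> minus the identity 2-Lipschitz. The integrand of
  the resulting integral equation is itself the density witnessing absolute continuity, and the
  exceptional null set is the one belonging to the primitive of \<open>lam\<close>.\<close>

lemma (in bounded_rate) strong_global_solution_exists:
  fixes T :: "'a::{real_inner, complete_space} \<Rightarrow> 'a"
  assumes T: "nonexpansive T"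
  shows "\<exists>x. strong_global_solution T lam x0 x"
proof -
  define F where "F = (\<lambda>p. T p - p)"
  have "2-lipschitz_on UNIV F"
  proof (rule lipschitz_onI)
    fix p q
    have "norm (F p - F q) = norm ((T p - T q) - (p - q))"
      by (simp add: F_def algebra_simps)
    also have "\<dots> \<le> norm (T p - T q) + norm (p - q)"
      by (rule norm_triangle_ineq4)
    also have "\<dots> \<le> 2 * norm (p - q)"
      using T by (simp add: nonexpansive_def)
    finally show "dist (F p) (F q) \<le> 2 * dist p q"
      by (simp add: dist_norm)
  qed simp
  from ex_integral_equation_solution[OF this] obtain x where x_cont: "continuous_on {0..} x"
    and x: "\<And>t. t \<ge> 0 \<Longrightarrow> has_Bochner_integral (lebesgue_on {0..t}) (\<lambda>s. lam s *\<^sub>R F (x s)) (x t - x0)"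
    by blast
  have x_weak: "has_weak_integral (\<lambda>s. lam s *\<^sub>R F (x s)) (x t - x0) {0..t}" if "t \<ge> 0" for t
    using x[OF that] by (rule has_Bochner_integral_imp_has_weak_integral)
  have F_cont: "continuous_on {0..} (\<lambda>s. F (x s))"
    using lipschitz_on_continuous_on[OF \<open>2-lipschitz_on UNIV F\<close>] x_cont
    by (rule continuous_on_compose2) simp
  \<comment> \<open>On \<open>{0..0}\<close> the only argument is \<open>0\<close>, so this constant
    dominates the integrand, and its integral over a point is zero.\<close>
  have x_0: "x 0 = x0"
    using norm_has_weak_integral_le[OF x_weak integrable_const_ivl[of "norm (lam 0 *\<^sub>R F (x 0))"], of 0] by simp
  have "abs_continuous_upto b x" if "b > 0" for b
    unfolding abs_continuous_upto_def
  proof (intro exI[of _ "\<lambda>s. lam s *\<^sub>R F (x s)"] conjI ballI)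
    show "Bochner_integrable (lebesgue_on {0..b}) (\<lambda>s. lam s *\<^sub>R F (x s))"
      using x[of b] that by (auto simp: Bochner_integrable_def)
    fix t
    assume "t \<in> {0..b}"
    then show "\<exists>I. has_Bochner_integral (lebesgue_on {0..t}) (\<lambda>s. lam s *\<^sub>R F (x s)) I \<and> x t = x 0 + I"
      using x[of t] x_0 by (intro exI[of _ "x t - x0"]) auto
  qed
  moreover have "AE t in lebesgue_on {0..}.
      (x has_vector_derivative lam t *\<^sub>R (T (x t) - x t)) (at t within {0..})"
  proof -
    obtain N where N: "negligible N" "\<And>t. t \<notin> N \<Longrightarrow> 0 \<le> t \<Longrightarrow>
        ((\<lambda>s. integral {0..s} lam) has_real_derivative lam t) (at t within {0..})"
      using integral_has_real_derivative_ae[OF rate_integrable, of 0] by blast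
    have "(x has_vector_derivative lam t *\<^sub>R (T (x t) - x t)) (at t within {0..})" if "t \<notin> N" "0 \<le> t" for t
    proof -
      have "((\<lambda>t. x t - x0) has_vector_derivative lam t *\<^sub>R F (x t)) (at t within {0..})"
        by (rule primitive_has_vector_derivative[OF x_weak F_cont that(2) N(2)[OF that]])
      from has_vector_derivative_add[OF this has_vector_derivative_const[of x0]]
      show ?thesis
        by (simp add: F_def)
    qed
    moreover have "AE t in lebesgue. t \<notin> N"
      using N(1) by (simp add: negligible_iff_null_sets AE_not_in)
    ultimately show ?thesis
      by (subst AE_restrict_space_iff) (auto elim!: eventually_mono)
  qed
  ultimately show ?thesis
    using x_0 unfolding strong_global_solution_def by blast
qed

section \<open>Uniqueness\<close>

text \<open>The norm of the vector density serves as a scalar majorant of all increments; in this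
  form absolute continuity enters the uniqueness argument.\<close>

lemma abs_continuous_upto_increment_le:
  fixes f :: "real \<Rightarrow> 'a::real_inner"
  assumes "abs_continuous_upto b f"
  obtains k where "k integrable_on {0..b}" "\<And>s. 0 \<le> k s"
    "\<And>u v. 0 \<le> u \<Longrightarrow> u \<le> v \<Longrightarrow> v \<le> b \<Longrightarrow> norm (f v - f u) \<le> integral {u..v} k"
proof -
  obtain g where g: "Bochner_integrable (lebesgue_on {0..b}) g"
    and f: "\<And>t. t \<in> {0..b} \<Longrightarrow> \<exists>I. has_Bochner_integral (lebesgue_on {0..t}) g I \<and> f t = f 0 + I"
    using assms unfolding abs_continuous_upto_def by blast
  show thesis
  proof
    show "(\<lambda>s. norm (g s)) integrable_on {0..b}"
      using g unfolding Bochner_integrable_def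
      by (auto intro: integrable_on_lebesgue_on has_Bochner_integral_integrable_norm)
    fix u v :: real
    assume uv: "0 \<le> u" "u \<le> v" "v \<le> b"
    then obtain I J where "has_Bochner_integral (lebesgue_on {0..u}) g I" "f u = f 0 + I"
      "has_Bochner_integral (lebesgue_on {0..v}) g J" "f v = f 0 + J"
      using f[of u] f[of v] by auto
    then show "norm (f v - f u) \<le> integral {u..v} (\<lambda>s. norm (g s))"
      using has_Bochner_integral_increment_le uv by simp
  qed simp
qed

lemma strong_global_solution_unique:
  fixes T :: "'a::real_inner \<Rightarrow> 'a"
  assumes T: "nonexpansive T" and lam: "\<And>t. 0 \<le> t \<Longrightarrow> 0 \<le> lam t"
    and x: "strong_global_solution T lam x0 x" and y: "strong_global_solution T lam x0 y"
    and b: "0 \<le> b"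
  shows "y b = x b"
proof (cases "b = 0")
  case True
  then show ?thesis
    using x y by (simp add: strong_global_solution_def)
next
  case False
  with b have "b > 0" by simp
  define d where "d = (\<lambda>t. y t - x t)"
  define p where "p = (\<lambda>t. lam t *\<^sub>R ((T (y t) - y t) - (T (x t) - x t)))"
  have d_0: "d 0 = 0"
    using x y by (simp add: strong_global_solution_def d_def)
  obtain k1 where k1: "k1 integrable_on {0..b}" "\<And>s. 0 \<le> k1 s"
    "\<And>u v. 0 \<le> u \<Longrightarrow> u \<le> v \<Longrightarrow> v \<le> b \<Longrightarrow> norm (x v - x u) \<le> integral {u..v} k1"
    using x \<open>b > 0\<close> abs_continuous_upto_increment_le[of b x] unfolding strong_global_solution_def by blast
  obtain k2 where k2: "k2 integrable_on {0..b}" "\<And>s. 0 \<le> k2 s"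
    "\<And>u v. 0 \<le> u \<Longrightarrow> u \<le> v \<Longrightarrow> v \<le> b \<Longrightarrow> norm (y v - y u) \<le> integral {u..v} k2"
    using y \<open>b > 0\<close> abs_continuous_upto_increment_le[of b y] unfolding strong_global_solution_def by blast
  define k where "k = (\<lambda>s. k1 s + k2 s)"
  have k: "k integrable_on {u..v}" if "0 \<le> u" "v \<le> b" for u v
    unfolding k_def using that k1(1) k2(1) by (intro integrable_add) (auto intro: integrable_on_subinterval)
  have d_inc: "norm (d v - d u) \<le> integral {u..v} k" if "0 \<le> u" "u \<le> v" "v \<le> b" for u v
  proof -
    have "norm (d v - d u) = norm ((y v - y u) - (x v - x u))"
      by (simp add: d_def algebra_simps)
    also have "\<dots> \<le> norm (y v - y u) + norm (x v - x u)"
      by (rule norm_triangle_ineq4)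
    also have "\<dots> \<le> integral {u..v} k2 + integral {u..v} k1"
      using k1(3) k2(3) that by (intro add_mono) auto
    also have "\<dots> = integral {u..v} k"
      unfolding k_def using that k1(1) k2(1)
      by (subst integral_add) (auto intro: integrable_on_subinterval)
    finally show ?thesis .
  qed
  \<comment> \<open>A bound for \<open>norm (d t)\<close> on \<open>{0..b}\<close>. Factoring a
    difference of squares then gives the majorant \<open>2 * R * k\<close> for the increments of the
    squared norm.\<close>
  define R where "R = integral {0..b} k"
  have d_le: "norm (d t) \<le> R" if "0 \<le> t" "t \<le> b" for t
  proof -
    have "norm (d t) \<le> integral {0..t} k"
      using d_inc[of 0 t] that d_0 by simp
    also have "\<dots> \<le> R"
      unfolding R_def using that k k1(2) k2(2)
      by (intro integral_subset_le) (auto simp: k_def)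
    finally show ?thesis .
  qed
  have ae: "AE t in lebesgue. 0 \<le> t \<longrightarrow> (d has_vector_derivative p t) (at t within {0..})"
  proof -
    have "AE t in lebesgue_on {0..}. (d has_vector_derivative p t) (at t within {0..})"
      using conjunct1[OF conjunct2[OF x[unfolded strong_global_solution_def]]]
        conjunct1[OF conjunct2[OF y[unfolded strong_global_solution_def]]]
    proof eventually_elim
      case (elim t)
      then show ?case
        unfolding d_def p_def scaleR_diff_right[of "lam t" "T (y t) - y t"]
        by (intro has_vector_derivative_diff)
    qed
    then show ?thesis
      by (subst (asm) AE_restrict_space_iff) auto
  qed
  \<comment> \<open>The exact exceptional set. Lebesgue measure is complete, so this set is itself
    null.\<close>
  define N where "N = {t. \<not> (0 \<le> t \<longrightarrow> (d has_vector_derivative p t) (at t within {0..}))}"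
  have "negligible N"
    using ae by (simp add: N_def negligible_iff_null_sets completion.AE_iff_null_sets)
  have "norm (d b) ^ 2 \<le> norm (d 0) ^ 2"
  proof (rule ae_nonpos_derivative_imp_le[OF b \<open>negligible N\<close>])
    show "(\<lambda>s. 2 * R * k s) integrable_on {0..b}"
      using k by (intro integrable_on_mult_right) auto
    show "norm (d v) ^ 2 - norm (d u) ^ 2 \<le> integral {u..v} (\<lambda>s. 2 * R * k s)"
      if "0 \<le> u" "u \<le> v" "v \<le> b" for u v
    proof -
      have "norm (d v) ^ 2 - norm (d u) ^ 2 = (norm (d v) + norm (d u)) * (norm (d v) - norm (d u))"
        by (simp add: power2_eq_square algebra_simps)
      also have "\<dots> \<le> (norm (d v) + norm (d u)) * norm (d v - d u)"
        by (intro mult_left_mono norm_triangle_ineq2) simp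
      also have "\<dots> \<le> (2 * R) * integral {u..v} k"
        using d_le[of u] d_le[of v] d_inc order_trans[OF norm_ge_zero d_le[of u]] that
        by (intro mult_mono) auto
      finally show ?thesis
        by simp
    qed
    show "((\<lambda>t. norm (d t) ^ 2) has_real_derivative 2 * (d t \<bullet> p t)) (at t within {0..b})"
      if "t \<in> {0..b} - N" for t
    proof -
      have "(d has_vector_derivative p t) (at t within {0..})"
        using that by (auto simp: N_def)
      then have "(d has_vector_derivative p t) (at t within {0..b})"
        by (rule has_vector_derivative_within_subset) auto
      then have "((\<lambda>t. d t \<bullet> d t) has_vector_derivative d t \<bullet> p t + p t \<bullet> d t) (at t within {0..b})"
        unfolding has_vector_derivative_def
        by (auto intro!: derivative_eq_intros simp: algebra_simps)
      then show ?thesis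
        by (simp add: has_real_derivative_iff_has_vector_derivative power2_norm_eq_inner inner_commute)
    qed
    show "2 * (d t \<bullet> p t) \<le> 0" if "t \<in> {0..b} - N" for t
    proof -
      have "d t \<bullet> (T (y t) - T (x t)) \<le> norm (d t) * norm (T (y t) - T (x t))"
        by (rule norm_cauchy_schwarz)
      also have "\<dots> \<le> norm (d t) * norm (d t)"
        using T by (intro mult_left_mono) (auto simp: nonexpansive_def d_def)
      finally have "d t \<bullet> (T (y t) - T (x t)) - d t \<bullet> d t \<le> 0"
        by (simp add: dot_square_norm power2_eq_square)
      moreover have "d t \<bullet> p t = lam t * (d t \<bullet> (T (y t) - T (x t)) - d t \<bullet> d t)"
        by (simp add: p_def d_def inner_diff_right algebra_simps)
      ultimately show ?thesis
        using lam[of t] that by (simp add: mult_nonneg_nonpos)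
    qed
  qed
  then show ?thesis
    by (simp add: d_0) (simp add: d_def)
qed

section \<open>Passage from a rate on the half-line to one on the whole line\<close>

lemma strong_global_solution_cong:
  assumes "\<And>t. 0 \<le> t \<Longrightarrow> lam t = lam' t"
  shows "strong_global_solution T lam x0 x \<longleftrightarrow> strong_global_solution T lam' x0 x"
proof -
  have "(AE t in lebesgue_on {0..}. (x has_vector_derivative lam t *\<^sub>R (T (x t) - x t)) (at t within {0..}))
    \<longleftrightarrow> (AE t in lebesgue_on {0..}. (x has_vector_derivative lam' t *\<^sub>R (T (x t) - x t)) (at t within {0..}))"
    using assms by (intro AE_cong) simp
  then show ?thesis
    by (simp add: strong_global_solution_def)
qed

theorem mainTheorem1:
  fixes T :: "'a::{real_inner, complete_space} \<Rightarrow> 'a"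
    and lam :: "real \<Rightarrow> real"
    and x0 :: 'a
  assumes "nonexpansive T"
    and "lam \<in> borel_measurable (lebesgue_on {0..})"
    and "\<And>t. 0 \<le> t \<Longrightarrow> lam t \<in> {0..1}"
  shows "\<exists>x. strong_global_solution T lam x0 x \<and>
           (\<forall>y. strong_global_solution T lam x0 y \<longrightarrow> (\<forall>t\<ge>0. y t = x t))"
proof -
  \<comment> \<open>Extension by zero preserves measurability and the bounds, and it does not change
    which functions are solutions.\<close>
  define lam' where "lam' = (\<lambda>t. if t \<in> {0..} then lam t else 0)"
  interpret bounded_rate lam'
  proof
    show "lam' \<in> borel_measurable lebesgue"
      unfolding lam'_def using assms(2) by (intro borel_measurable_if_I) auto
    show "0 \<le> lam' t" "lam' t \<le> 1" for t
      using assms(3)[of t] by (auto simp: lam'_def)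
  qed
  have "strong_global_solution T lam x0 x \<longleftrightarrow> strong_global_solution T lam' x0 x" for x
    by (rule strong_global_solution_cong) (simp add: lam'_def)
  then obtain x where x: "strong_global_solution T lam x0 x"
    using strong_global_solution_exists[OF assms(1)] by blast
  moreover have "y t = x t" if "strong_global_solution T lam x0 y" "t \<ge> 0" for y t
    using assms(3) by (intro strong_global_solution_unique[OF assms(1) _ x that]) auto
  ultimately show ?thesis
    by blast
qed

end
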